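(* Given a convex set $\Xi\subseteq\mathbb{R}^m$, a norm $\|\cdot\|$ on $\mathbb{R}^m$, points $\widehat\xi_1,\dots,\widehat\xi_N\in\Xi$, $\widehat{\mathbb P}_N=\frac1N\sum_{i=1}^N\delta_{\widehat\xi_i}$, a law-invariant coherent risk measure $\rho$ and $\varepsilon>0$, consider the worst-case expectation problem $\sup_\Pi\mathbb{E}^\Pi[\ell(\xi)]$ over the feasible set of all probability distributions $\Pi$ on $\Xi\times\Xi$ of a pair $(\widehat\xi,\xi)$ with first marginal $\widehat{\mathbb P}_N$ and $\rho^\Pi(\|\widehat\xi-\xi\|)\le\varepsilon$. This feasible set of $\Pi$ may be nonconvex (i.e. there exist such $\Xi,\|\cdot\|,N,\widehat\xi_1,\dots,\widehat\xi_N,\rho,\varepsilon$ for which it is not a convex set of distributions), and thus the worst-case expectation problem is a nonconvex optimization problem in general.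
   Context: A law-invariant coherent risk measure $\rho$ is a functional on nonnegative random variables satisfying $\rho(0)=0$, translation invariance $\rho(X+c)=\rho(X)+c$ for $c\ge0$, monotonicity, subadditivity, positive homogeneity $\rho(cX)=c\rho(X)$ for $c>0$, and law invariance. $\rho^{\Pi}(\|\widehat\xi-\xi\|)$ is the value of $\rho$ on the law of $\|\widehat\xi-\xi\|$ when $(\widehat\xi,\xi)\sim\Pi$. Convexity of a set of distributions refers to mixtures $(1-\lambda)\Pi_1+\lambda\Pi_2$, $\lambda\in[0,1]$. *)

theory Defs
  imports "HOL-Probability.Probability"
begin

definition is_norm :: "('a::real_vector \<Rightarrow> real) \<Rightarrow> bool" where
  "is_norm nrm \<longleftrightarrow>
     (\<forall>x. 0 \<le> nrm x) \<and>
     (\<forall>x. nrm x = 0 \<longleftrightarrow> x = 0) \<and>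
     (\<forall>c x. nrm (c *\<^sub>R x) = \<bar>c\<bar> * nrm x) \<and>
     (\<forall>x y. nrm (x + y) \<le> nrm x + nrm y)"

definition nonneg_rv :: "'w measure \<Rightarrow> ('w \<Rightarrow> real) \<Rightarrow> bool" where
  "nonneg_rv M X \<longleftrightarrow> X \<in> borel_measurable M \<and> (\<forall>w\<in>space M. 0 \<le> X w)"

(* rho M X is the risk of the random variable X on the probability space M, that is rho^M(X).
   Law invariance compares random variables living on different probability spaces, so that
   rho M X is the value of rho on the law of X under M.  Risks may be infinite: no restriction
   is put on the tails of X. *)
definition law_invariant_coherent_risk_measure ::
  "('w measure \<Rightarrow> ('w \<Rightarrow> real) \<Rightarrow> ennreal) \<Rightarrow> bool" where
  "law_invariant_coherent_risk_measure \<rho> \<longleftrightarrow>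
     (\<forall>M. prob_space M \<longrightarrow> \<rho> M (\<lambda>_. 0) = 0) \<and>
     (\<forall>M X c. prob_space M \<and> nonneg_rv M X \<and> 0 \<le> c \<longrightarrow>
        \<rho> M (\<lambda>w. X w + c) = \<rho> M X + ennreal c) \<and>
     (\<forall>M X Y. prob_space M \<and> nonneg_rv M X \<and> nonneg_rv M Y \<and> (AE w in M. X w \<le> Y w) \<longrightarrow>
        \<rho> M X \<le> \<rho> M Y) \<and>
     (\<forall>M X Y. prob_space M \<and> nonneg_rv M X \<and> nonneg_rv M Y \<longrightarrow>
        \<rho> M (\<lambda>w. X w + Y w) \<le> \<rho> M X + \<rho> M Y) \<and>
     (\<forall>M X c. prob_space M \<and> nonneg_rv M X \<and> 0 < c \<longrightarrow>
        \<rho> M (\<lambda>w. c * X w) = ennreal c * \<rho> M X) \<and>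
     (\<forall>M M' X Y. prob_space M \<and> prob_space M' \<and> nonneg_rv M X \<and> nonneg_rv M' Y \<and>
        distr M borel X = distr M' borel Y \<longrightarrow> \<rho> M X = \<rho> M' Y)"

(* The law of xi I for a uniformly drawn index I in {1..N}; the points may repeat.
   See emeasure_empirical_distribution for the formula as an average of Dirac measures. *)
definition empirical_distribution ::
  "'a::topological_space set \<Rightarrow> nat \<Rightarrow> (nat \<Rightarrow> 'a) \<Rightarrow> 'a measure" where
  "empirical_distribution \<Xi> N xi =
     distr (uniform_count_measure {1..N}) (restrict_space borel \<Xi>) xi"

lemma emeasure_empirical_distribution:
  assumes "1 \<le> N" "\<And>i. i \<in> {1..N} \<Longrightarrow> xi i \<in> \<Xi>" "A \<in> sets (restrict_space borel \<Xi>)"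
  shows "emeasure (empirical_distribution \<Xi> N xi) A =
           ennreal (1 / real N) * (\<Sum>i\<in>{1..N}. emeasure (return (restrict_space borel \<Xi>) (xi i)) A)"
proof -
  have m: "xi \<in> measurable (uniform_count_measure {1..N}) (restrict_space borel \<Xi>)"
    using assms(2)
    by (auto simp: measurable_def space_uniform_count_measure sets_uniform_count_measure
        space_restrict_space)
  let ?B = "xi -` A \<inter> {1..N}"
  have "emeasure (empirical_distribution \<Xi> N xi) A = emeasure (uniform_count_measure {1..N}) ?B"
    unfolding empirical_distribution_def
    using emeasure_distr[OF m assms(3)] by (simp only: space_uniform_count_measure)
  also have "\<dots> = ennreal (real (card ?B) / real N)"
    using assms(1) by (subst emeasure_uniform_count_measure) auto
  also have "\<dots> = ennreal (1 / real N) * ennreal (real (card ?B))"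
    by (simp add: ennreal_mult[symmetric])
  also have "ennreal (real (card ?B)) = (\<Sum>i\<in>{1..N}. indicator A (xi i))"
  proof -
    have "(\<Sum>i\<in>{1..N}. indicator A (xi i)) = (\<Sum>i\<in>{1..N}. indicator ?B i :: ennreal)"
      by (intro sum.cong) (auto simp: indicator_def)
    also have "\<dots> = of_nat (card ({1..N} \<inter> ?B))"
      by (auto simp: indicator_def sum.If_cases intro!: arg_cong[where f = card])
    also have "{1..N} \<inter> ?B = ?B" by auto
    finally show ?thesis by (simp add: ennreal_of_nat_eq_real_of_nat)
  qed
  finally show ?thesis
    using assms(3) by simp
qed

(* The distributions on \<Xi> \<times> \<Xi> carry the trace of the Borel sets, as a convex set \<Xi> need not
   be a Borel set itself. *)
definition feasible_set ::
  "(real ^ 'm) set \<Rightarrow> (real ^ 'm \<Rightarrow> real) \<Rightarrow> nat \<Rightarrow> (nat \<Rightarrow> real ^ 'm) \<Rightarrow>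
   (((real ^ 'm) \<times> (real ^ 'm)) measure \<Rightarrow> ((real ^ 'm) \<times> (real ^ 'm) \<Rightarrow> real) \<Rightarrow> ennreal) \<Rightarrow> real \<Rightarrow>
   ((real ^ 'm) \<times> (real ^ 'm)) measure set" where
  "feasible_set \<Xi> nrm N xi \<rho> \<epsilon> =
     {P. prob_space P \<and>
         sets P = sets (restrict_space borel (\<Xi> \<times> \<Xi>)) \<and>
         distr P (restrict_space borel \<Xi>) fst = empirical_distribution \<Xi> N xi \<and>
         \<rho> P (\<lambda>(x, y). nrm (x - y)) \<le> ennreal \<epsilon>}"

definition mixture :: "real \<Rightarrow> 'a measure \<Rightarrow> 'a measure \<Rightarrow> 'a measure" where
  "mixture l M1 M2 = measure_of (space M1) (sets M1)
     (\<lambda>A. ennreal (1 - l) * emeasure M1 A + ennreal l * emeasure M2 A)"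

lemma sets_mixture [simp]: "sets (mixture l M1 M2) = sets M1"
  by (simp add: mixture_def)

lemma emeasure_mixture:
  assumes "sets M2 = sets M1" "A \<in> sets M1"
  shows "emeasure (mixture l M1 M2) A =
           ennreal (1 - l) * emeasure M1 A + ennreal l * emeasure M2 A"
  unfolding mixture_def
proof (rule emeasure_measure_of_sigma)
  show "sigma_algebra (space M1) (sets M1)" by (rule sets.sigma_algebra_axioms)
  show "positive (sets M1) (\<lambda>A. ennreal (1 - l) * emeasure M1 A + ennreal l * emeasure M2 A)"
    by (simp add: positive_def)
  show "countably_additive (sets M1)
          (\<lambda>A. ennreal (1 - l) * emeasure M1 A + ennreal l * emeasure M2 A)"
  proof (rule countably_additiveI)
    fix A :: "nat \<Rightarrow> 'a set"
    assume A: "range A \<subseteq> sets M1" "disjoint_family A"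
    have "(\<Sum>i. emeasure M1 (A i)) = emeasure M1 (\<Union>i. A i)"
      "(\<Sum>i. emeasure M2 (A i)) = emeasure M2 (\<Union>i. A i)"
      using A assms(1) by (auto intro!: suminf_emeasure)
    then show "(\<Sum>i. ennreal (1 - l) * emeasure M1 (A i) + ennreal l * emeasure M2 (A i)) =
        ennreal (1 - l) * emeasure M1 (\<Union>i. A i) + ennreal l * emeasure M2 (\<Union>i. A i)"
      by (simp add: suminf_add[symmetric])
  qed
qed fact

definition mixture_convex :: "'a measure set \<Rightarrow> bool" where
  "mixture_convex F \<longleftrightarrow> (\<forall>P1\<in>F. \<forall>P2\<in>F. \<forall>l\<in>{0..1}. mixture l P1 P2 \<in> F)"

(* Integrands whose positive and negative part both have infinite integral get the value
   -\<infinity>, so that such distributions are irrelevant for a supremum. *)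
definition extended_expectation :: "'a measure \<Rightarrow> ('a \<Rightarrow> real) \<Rightarrow> ereal" where
  "extended_expectation M f =
     (if (\<integral>\<^sup>+ x. ennreal (f x) \<partial>M) = \<infinity> \<and> (\<integral>\<^sup>+ x. ennreal (- f x) \<partial>M) = \<infinity> then -\<infinity>
      else enn2ereal (\<integral>\<^sup>+ x. ennreal (f x) \<partial>M) - enn2ereal (\<integral>\<^sup>+ x. ennreal (- f x) \<partial>M))"

(* Concavity of an extended real valued objective means convexity of its hypograph. *)
definition mixture_concave_on ::
  "'a measure set \<Rightarrow> ('a measure \<Rightarrow> ereal) \<Rightarrow> bool" where
  "mixture_concave_on F J \<longleftrightarrow>
     (\<forall>P1\<in>F. \<forall>P2\<in>F. \<forall>l\<in>{0..1}. \<forall>a b :: real.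
        ereal a \<le> J P1 \<and> ereal b \<le> J P2 \<longrightarrow>
        ereal ((1 - l) * a + l * b) \<le> J (mixture l P1 P2))"

(* The problem of maximising J over F. *)
definition convex_maximization_problem ::
  "'a measure set \<Rightarrow> ('a measure \<Rightarrow> ereal) \<Rightarrow> bool" where
  "convex_maximization_problem F J \<longleftrightarrow> mixture_convex F \<and> mixture_concave_on F J"

end

theory Submission
  imports Defs
begin

text \<open>
  Convexity fails because a coherent risk measure need not be quasiconvex in the law of its
  argument: subadditivity concerns sums of random variables, not mixtures of their laws. A
  convenient witness is half the sum of the mean and the essential supremum. The mean is affine
  under mixing, but every proper mixture has as essential supremum the larger of the two essential
  suprema (\<open>esssup_mixture\<close>). Mixing a law with a constant strictly between its mean and its
  supremum therefore raises the mean of that law and keeps its supremum; if the constant is chosen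
  to have the same risk as the law, then the mixture has a larger risk than both.

  For one data point at the origin every law of a distance on \<open>[0, \<infinity>)\<close> comes from a law on
  pairs with the right first marginal, by moving the point along a fixed unit vector. Take \<open>\<epsilon> = 3\<close> and the
  distance either constantly 3, with risk \<open>(3 + 3) / 2 = 3\<close>, or uniform on \<open>{0, 4}\<close>, with risk
  \<open>(2 + 4) / 2 = 3\<close>. Both are feasible, but their equal mixture has mean \<open>5 / 2\<close> and essential
  supremum 4, hence risk \<open>13 / 4 > 3\<close>. The worst-case problem is then nonconvex for every loss
  function, because its feasible set already is.
\<close>

section \<open>Mixtures of measures\<close>

lemma space_mixture [simp]: "space (mixture l M1 M2) = space M1"
  by (simp add: mixture_def space_measure_of_conv)

lemma measurable_mixture [simp]: "measurable (mixture l M1 M2) N = measurable M1 N"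
  by (rule measurable_cong_sets) simp_all

lemma prob_space_mixture:
  assumes "prob_space M1" "prob_space M2" "sets M2 = sets M1" "l \<in> {0..1}"
  shows "prob_space (mixture l M1 M2)"
proof (rule prob_spaceI)
  have "emeasure (mixture l M1 M2) (space M1) = ennreal (1 - l) + ennreal l"
    using prob_space.emeasure_space_1[OF assms(1)] prob_space.emeasure_space_1[OF assms(2)]
      sets_eq_imp_space_eq[OF assms(3)]
    by (simp add: emeasure_mixture[OF assms(3)])
  also have "\<dots> = 1"
    using assms(4) by (simp flip: ennreal_plus)
  finally show "emeasure (mixture l M1 M2) (space (mixture l M1 M2)) = 1"
    by simp
qed

lemma distr_mixture:
  assumes "sets M2 = sets M1" "f \<in> measurable M1 N"
  shows "distr (mixture l M1 M2) N f = mixture l (distr M1 N f) (distr M2 N f)"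
proof (rule measure_eqI)
  have f2: "f \<in> measurable M2 N"
    using assms by (simp cong: measurable_cong_sets)
  fix A assume "A \<in> sets (distr (mixture l M1 M2) N f)"
  then have A: "A \<in> sets N" by simp
  have "f -` A \<inter> space M1 \<in> sets M1"
    using assms(2) A by (rule measurable_sets)
  then show "emeasure (distr (mixture l M1 M2) N f) A =
      emeasure (mixture l (distr M1 N f) (distr M2 N f)) A"
    using A assms f2 sets_eq_imp_space_eq[OF assms(1)]
    by (simp add: emeasure_distr emeasure_mixture)
qed simp

lemma mixture_same:
  assumes "l \<in> {0..1}"
  shows "mixture l M M = M"
proof (rule measure_eqI)
  fix A assume "A \<in> sets (mixture l M M)"
  then have "emeasure (mixture l M M) A = (ennreal (1 - l) + ennreal l) * emeasure M A"
    by (simp add: emeasure_mixture distrib_right)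
  also have "ennreal (1 - l) + ennreal l = 1"
    using assms by (simp flip: ennreal_plus)
  finally show "emeasure (mixture l M M) A = emeasure M A"
    by simp
qed simp

lemma nn_integral_mixture:
  assumes sets: "sets M2 = sets M1" and "f \<in> borel_measurable M1"
  shows "(\<integral>\<^sup>+x. f x \<partial>mixture l M1 M2) =
           ennreal (1 - l) * (\<integral>\<^sup>+x. f x \<partial>M1) + ennreal l * (\<integral>\<^sup>+x. f x \<partial>M2)"
  using assms(2)
proof (induction rule: borel_measurable_induct)
  case (cong f g)
  have "(\<integral>\<^sup>+x. f x \<partial>M) = (\<integral>\<^sup>+x. g x \<partial>M)" if "space M = space M1" for M
    using cong(3) that by (intro nn_integral_cong) simp
  with cong(4) show ?case
    using sets_eq_imp_space_eq[OF sets] by simp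
next
  case (set A)
  then show ?case
    using sets by (simp add: emeasure_mixture)
next
  case (mult u c)
  then have "u \<in> borel_measurable M2"
    using sets by (simp cong: measurable_cong_sets)
  with mult show ?case
    by (simp add: nn_integral_cmult distrib_left mult.left_commute)
next
  case (add u v)
  then have "u \<in> borel_measurable M2" "v \<in> borel_measurable M2"
    using sets by (simp_all cong: measurable_cong_sets)
  with add show ?case
    by (simp add: nn_integral_add distrib_left ac_simps)
next
  case (seq U)
  have U2: "U i \<in> borel_measurable M2" for i
    using seq(1)[of i] sets by (simp cong: measurable_cong_sets)
  have inc: "incseq (\<lambda>i. c * (\<integral>\<^sup>+x. U i x \<partial>M))" for c :: ennreal and M
    using \<open>incseq U\<close> by (auto simp: incseq_def le_fun_def intro!: mult_left_mono nn_integral_mono)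
  have "(\<integral>\<^sup>+x. (SUP i. U i x) \<partial>mixture l M1 M2) =
      (SUP i. ennreal (1 - l) * (\<integral>\<^sup>+x. U i x \<partial>M1) + ennreal l * (\<integral>\<^sup>+x. U i x \<partial>M2))"
    using seq by (simp add: nn_integral_monotone_convergence_SUP)
  also have "\<dots> = ennreal (1 - l) * (SUP i. \<integral>\<^sup>+x. U i x \<partial>M1) + ennreal l * (SUP i. \<integral>\<^sup>+x. U i x \<partial>M2)"
    by (simp add: ennreal_SUP_add inc SUP_mult_left_ennreal)
  also have "\<dots> = ennreal (1 - l) * (\<integral>\<^sup>+x. (SUP i. U i x) \<partial>M1) + ennreal l * (\<integral>\<^sup>+x. (SUP i. U i x) \<partial>M2)"
    using seq U2 by (simp add: nn_integral_monotone_convergence_SUP)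
  finally show ?case
    by (simp add: SUP_apply image_comp)
qed

lemma AE_mixture:
  assumes sets: "sets M2 = sets M1" and l: "0 < l" "l < 1" and P: "Measurable.pred M1 P"
  shows "(AE x in mixture l M1 M2. P x) \<longleftrightarrow> (AE x in M1. P x) \<and> (AE x in M2. P x)"
proof -
  have sp: "space M2 = space M1"
    by (rule sets_eq_imp_space_eq[OF sets])
  have meas: "{x \<in> space M1. \<not> P x} \<in> sets M1"
    using P by measurable
  then show ?thesis
    using l sets AE_iff_measurable[of "{x \<in> space M1. \<not> P x}" "mixture l M1 M2" P]
      AE_iff_measurable[of "{x \<in> space M1. \<not> P x}" M1 P]
      AE_iff_measurable[of "{x \<in> space M1. \<not> P x}" M2 P]
    by (simp add: sp emeasure_mixture)
qed

text \<open>
  A weight strictly between 0 and 1 cannot hide any mass of either component, so a bound holds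
  almost everywhere for the mixture exactly when it does for both components.
\<close>
lemma esssup_mixture:
  fixes f :: "'a \<Rightarrow> ennreal"
  assumes sets: "sets M2 = sets M1" and l: "0 < l" "l < 1" and f: "f \<in> borel_measurable M1"
  shows "esssup (mixture l M1 M2) f = max (esssup M1 f) (esssup M2 f)"
proof -
  have f2: "f \<in> borel_measurable M2"
    using f sets by (simp cong: measurable_cong_sets)
  have AE_iff: "(AE x in mixture l M1 M2. f x \<le> z) \<longleftrightarrow> (AE x in M1. f x \<le> z) \<and> (AE x in M2. f x \<le> z)"
    for z
    using f by (intro AE_mixture[OF sets l]) measurable
  show ?thesis
  proof (rule antisym)
    have "AE x in M1. f x \<le> max (esssup M1 f) (esssup M2 f)"
      using esssup_AE[of f M1] by eventually_elim (simp add: le_max_iff_disj)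
    moreover have "AE x in M2. f x \<le> max (esssup M1 f) (esssup M2 f)"
      using esssup_AE[of f M2] by eventually_elim (simp add: le_max_iff_disj)
    ultimately show "esssup (mixture l M1 M2) f \<le> max (esssup M1 f) (esssup M2 f)"
      using f AE_iff by (intro esssup_I) simp_all
    show "max (esssup M1 f) (esssup M2 f) \<le> esssup (mixture l M1 M2) f"
      using f f2 AE_iff[of "esssup (mixture l M1 M2) f"] esssup_AE[of f "mixture l M1 M2"]
      by (auto intro: esssup_I)
  qed
qed

section \<open>The average of the mean and the essential supremum\<close>

text \<open>
  The factor \<open>1/2\<close> makes the risk of a constant equal to that constant, as translation invariance
  demands.
\<close>
definition mean_esssup_risk :: "'w measure \<Rightarrow> ('w \<Rightarrow> real) \<Rightarrow> ennreal" where
  "mean_esssup_risk M X =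
     ennreal (1/2) * ((\<integral>\<^sup>+w. ennreal (X w) \<partial>M) + esssup M (\<lambda>w. ennreal (X w)))"

lemma esssup_ennreal_add_const:
  fixes f :: "'a \<Rightarrow> ennreal"
  assumes f: "f \<in> borel_measurable M" and M: "emeasure M (space M) \<noteq> 0" and c: "c \<noteq> top"
  shows "esssup M (\<lambda>x. f x + c) = esssup M f + c"
proof (rule antisym)
  show "esssup M (\<lambda>x. f x + c) \<le> esssup M f + c"
    using f esssup_AE[of f M] by (intro esssup_I) (auto elim!: eventually_mono intro: add_mono)
  let ?s = "esssup M (\<lambda>x. f x + c)"
  have AE: "AE x in M. f x + c \<le> ?s"
    by (rule esssup_AE)
  have "c = esssup M (\<lambda>x. c)"
    using M by (simp add: esssup_const)
  also have "\<dots> \<le> ?s"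
    by (rule esssup_mono) auto
  finally have "c \<le> ?s" .
  \<comment> \<open>Truncated subtraction is harmless here, as \<open>c \<le> ?s\<close> lets \<open>c\<close> be added back below.\<close>
  have "esssup M f \<le> ?s - c"
  proof (rule esssup_I[OF f])
    show "AE x in M. f x \<le> ?s - c"
      using AE
    proof eventually_elim
      case (elim x)
      have "f x = (f x + c) - c"
        using c by simp
      also have "\<dots> \<le> ?s - c"
        using elim by (rule ennreal_minus_mono) simp
      finally show ?case .
    qed
  qed
  then have "esssup M f + c \<le> (?s - c) + c"
    by (rule add_right_mono)
  then show "esssup M f + c \<le> ?s"
    using \<open>c \<le> ?s\<close> by (simp add: diff_add_cancel_ennreal)
qed

lemma esssup_ennreal_add_le:
  fixes f g :: "'a \<Rightarrow> ennreal"
  assumes "f \<in> borel_measurable M" "g \<in> borel_measurable M"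
  shows "esssup M (\<lambda>x. f x + g x) \<le> esssup M f + esssup M g"
proof (rule esssup_I)
  show "AE x in M. f x + g x \<le> esssup M f + esssup M g"
    using esssup_AE[of f M] esssup_AE[of g M] by eventually_elim (rule add_mono)
qed (use assms in measurable)

text \<open>
  For a positive real factor this inequality is an equality, since it also applies to the inverse
  factor.
\<close>
lemma esssup_ennreal_cmult_le:
  fixes f :: "'a \<Rightarrow> ennreal"
  assumes "f \<in> borel_measurable M"
  shows "esssup M (\<lambda>x. c * f x) \<le> c * esssup M f"
proof (rule esssup_I)
  show "AE x in M. c * f x \<le> c * esssup M f"
    using esssup_AE[of f M] by eventually_elim (rule mult_left_mono, simp_all)
qed (use assms in measurable)

lemma esssup_ennreal_cmult:
  fixes f :: "'a \<Rightarrow> ennreal"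
  assumes f: "f \<in> borel_measurable M" and c: "0 < c"
  shows "esssup M (\<lambda>x. ennreal c * f x) = ennreal c * esssup M f"
proof (rule antisym)
  show "esssup M (\<lambda>x. ennreal c * f x) \<le> ennreal c * esssup M f"
    using f by (rule esssup_ennreal_cmult_le)
  have inv: "ennreal (1/c) * (ennreal c * y) = y" "ennreal c * (ennreal (1/c) * y) = y" for y
    using c by (simp_all flip: mult.assoc ennreal_mult)
  have "esssup M f = esssup M (\<lambda>x. ennreal (1/c) * (ennreal c * f x))"
    by (simp only: inv)
  also have "\<dots> \<le> ennreal (1/c) * esssup M (\<lambda>x. ennreal c * f x)"
    using f by (intro esssup_ennreal_cmult_le) measurable
  finally have "ennreal c * esssup M f \<le> ennreal c * (ennreal (1/c) * esssup M (\<lambda>x. ennreal c * f x))"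
    by (rule mult_left_mono) simp
  then show "ennreal c * esssup M f \<le> esssup M (\<lambda>x. ennreal c * f x)"
    by (simp only: inv)
qed

lemma esssup_distr:
  fixes f :: "'b \<Rightarrow> ennreal"
  assumes g: "g \<in> measurable M N" and f: "f \<in> borel_measurable N"
  shows "esssup (distr M N g) f = esssup M (\<lambda>x. f (g x))"
proof -
  have "(AE y in distr M N g. f y \<le> z) \<longleftrightarrow> (AE x in M. f (g x) \<le> z)" for z
    using f by (intro AE_distr_iff[OF g]) measurable
  then show ?thesis
    using f g by (simp add: esssup_eq_AE)
qed

lemma mean_esssup_risk_distr:
  assumes "X \<in> borel_measurable M"
  shows "mean_esssup_risk M X = mean_esssup_risk (distr M borel X) (\<lambda>x. x)"
  using assms by (simp add: mean_esssup_risk_def nn_integral_distr esssup_distr)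

text \<open>
  Mean and essential supremum each have every coherence property, and all of these properties
  survive averaging. Law invariance holds because both are integrals or almost-everywhere bounds,
  which can be computed from the image law.
\<close>
lemma law_invariant_coherent_mean_esssup_risk:
  "law_invariant_coherent_risk_measure mean_esssup_risk"
  unfolding law_invariant_coherent_risk_measure_def
proof (intro conjI allI impI; (elim conjE)?)
  fix M :: "'a measure" assume "prob_space M"
  then interpret prob_space M .
  show "mean_esssup_risk M (\<lambda>_. 0) = 0"
    by (simp add: mean_esssup_risk_def esssup_const emeasure_space_1)
next
  fix M :: "'a measure" and X and c :: real
  assume "prob_space M" and X: "nonneg_rv M X" and c: "0 \<le> c"
  interpret prob_space M by fact
  have [measurable]: "X \<in> borel_measurable M"
    using X by (simp add: nonneg_rv_def)
  have plus: "ennreal (X w + c) = ennreal (X w) + ennreal c" if "w \<in> space M" for w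
    using X c that by (simp add: nonneg_rv_def)
  have "(\<integral>\<^sup>+w. ennreal (X w + c) \<partial>M) = (\<integral>\<^sup>+w. ennreal (X w) + ennreal c \<partial>M)"
    by (intro nn_integral_cong plus)
  also have "\<dots> = (\<integral>\<^sup>+w. ennreal (X w) \<partial>M) + ennreal c"
    by (simp add: nn_integral_add emeasure_space_1)
  finally have mean: "(\<integral>\<^sup>+w. ennreal (X w + c) \<partial>M) = (\<integral>\<^sup>+w. ennreal (X w) \<partial>M) + ennreal c" .
  have "esssup M (\<lambda>w. ennreal (X w + c)) = esssup M (\<lambda>w. ennreal (X w) + ennreal c)"
    by (intro esssup_AE_cong AE_I2 plus) measurable
  also have "\<dots> = esssup M (\<lambda>w. ennreal (X w)) + ennreal c"
    by (intro esssup_ennreal_add_const) (simp_all add: emeasure_space_1)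
  finally have sup: "esssup M (\<lambda>w. ennreal (X w + c)) = esssup M (\<lambda>w. ennreal (X w)) + ennreal c" .
  have half: "ennreal (1/2) * (ennreal c + ennreal c) = ennreal c"
    using c by (simp del: ennreal_half flip: ennreal_plus ennreal_mult)
  have "mean_esssup_risk M (\<lambda>w. X w + c) =
      mean_esssup_risk M X + ennreal (1/2) * (ennreal c + ennreal c)"
    unfolding mean_esssup_risk_def mean sup by (simp only: distrib_left distrib_right ac_simps)
  then show "mean_esssup_risk M (\<lambda>w. X w + c) = mean_esssup_risk M X + ennreal c"
    unfolding half .
next
  fix M :: "'a measure" and X Y
  assume "nonneg_rv M X" "nonneg_rv M Y" and le: "AE w in M. X w \<le> Y w"
  then have [measurable]: "X \<in> borel_measurable M"
    by (simp add: nonneg_rv_def)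
  have "AE w in M. ennreal (X w) \<le> ennreal (Y w)"
    using le by eventually_elim (rule ennreal_leI)
  then show "mean_esssup_risk M X \<le> mean_esssup_risk M Y"
    unfolding mean_esssup_risk_def
    by (intro mult_left_mono add_mono nn_integral_mono_AE esssup_AE_mono) simp_all
next
  fix M :: "'a measure" and X Y
  assume X: "nonneg_rv M X" and Y: "nonneg_rv M Y"
  have [measurable]: "X \<in> borel_measurable M" "Y \<in> borel_measurable M"
    using X Y by (simp_all add: nonneg_rv_def)
  have plus: "ennreal (X w + Y w) = ennreal (X w) + ennreal (Y w)" if "w \<in> space M" for w
    using X Y that by (simp add: nonneg_rv_def)
  have "(\<integral>\<^sup>+w. ennreal (X w + Y w) \<partial>M) = (\<integral>\<^sup>+w. ennreal (X w) + ennreal (Y w) \<partial>M)"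
    by (intro nn_integral_cong plus)
  then have mean: "(\<integral>\<^sup>+w. ennreal (X w + Y w) \<partial>M) =
      (\<integral>\<^sup>+w. ennreal (X w) \<partial>M) + (\<integral>\<^sup>+w. ennreal (Y w) \<partial>M)"
    by (simp add: nn_integral_add)
  have "esssup M (\<lambda>w. ennreal (X w + Y w)) = esssup M (\<lambda>w. ennreal (X w) + ennreal (Y w))"
    by (intro esssup_AE_cong AE_I2 plus) measurable
  also have "\<dots> \<le> esssup M (\<lambda>w. ennreal (X w)) + esssup M (\<lambda>w. ennreal (Y w))"
    by (intro esssup_ennreal_add_le) measurable
  finally have "mean_esssup_risk M (\<lambda>w. X w + Y w) \<le> ennreal (1/2) *
      (((\<integral>\<^sup>+w. ennreal (X w) \<partial>M) + (\<integral>\<^sup>+w. ennreal (Y w) \<partial>M)) +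
       (esssup M (\<lambda>w. ennreal (X w)) + esssup M (\<lambda>w. ennreal (Y w))))"
    unfolding mean_esssup_risk_def mean by (intro mult_left_mono add_mono) simp_all
  also have "\<dots> = mean_esssup_risk M X + mean_esssup_risk M Y"
    unfolding mean_esssup_risk_def by (simp only: distrib_left ac_simps)
  finally show "mean_esssup_risk M (\<lambda>w. X w + Y w) \<le> mean_esssup_risk M X + mean_esssup_risk M Y" .
next
  fix M :: "'a measure" and X and c :: real
  assume X: "nonneg_rv M X" and c: "0 < c"
  have [measurable]: "X \<in> borel_measurable M"
    using X by (simp add: nonneg_rv_def)
  have "ennreal (c * X w) = ennreal c * ennreal (X w)" for w
    using c by (simp add: ennreal_mult')
  then show "mean_esssup_risk M (\<lambda>w. c * X w) = ennreal c * mean_esssup_risk M X"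
    using c by (simp add: mean_esssup_risk_def nn_integral_cmult esssup_ennreal_cmult
        distrib_left mult.left_commute)
next
  fix M M' :: "'a measure" and X Y
  assume "nonneg_rv M X" "nonneg_rv M' Y" "distr M borel X = distr M' borel Y"
  then show "mean_esssup_risk M X = mean_esssup_risk M' Y"
    by (metis mean_esssup_risk_distr nonneg_rv_def)
qed

text \<open>
  The maximum in place of a second average is the source of the nonconvexity.
\<close>
lemma mean_esssup_risk_mixture:
  assumes "sets M2 = sets M1" "0 < l" "l < 1" "X \<in> borel_measurable M1"
  shows "mean_esssup_risk (mixture l M1 M2) X =
    ennreal (1/2) *
      ((ennreal (1 - l) * (\<integral>\<^sup>+w. ennreal (X w) \<partial>M1) + ennreal l * (\<integral>\<^sup>+w. ennreal (X w) \<partial>M2)) +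
       max (esssup M1 (\<lambda>w. ennreal (X w))) (esssup M2 (\<lambda>w. ennreal (X w))))"
  using assms by (simp add: mean_esssup_risk_def nn_integral_mixture esssup_mixture)

section \<open>Two feasible laws with an infeasible mixture\<close>

lemma esssup_return:
  fixes f :: "'a \<Rightarrow> ennreal"
  assumes "x \<in> space M" "f \<in> borel_measurable M"
  shows "esssup (return M x) f = f x"
proof -
  have "(AE y in return M x. f y \<le> z) \<longleftrightarrow> f x \<le> z" for z
    using assms by (intro AE_return) measurable
  then have "esssup (return M x) f = Inf {f x..}"
    using assms(2) by (simp add: esssup_eq_AE atLeast_def)
  then show ?thesis
    by simp
qed

lemma restrict_space_borel_UNIV: "restrict_space borel UNIV = borel"
  by (rule measure_eqI) (simp_all add: sets_restrict_space emeasure_restrict_space)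

lemma empirical_distribution_const:
  assumes "1 \<le> N"
  shows "empirical_distribution UNIV N (\<lambda>_. x) = return borel x"
  using assms unfolding empirical_distribution_def
  by (simp add: prob_space.distr_const prob_space_uniform_count_measure restrict_space_borel_UNIV)

theorem proposition6:
  "\<exists>(\<Xi> :: (real ^ 'm) set) (nrm :: real ^ 'm \<Rightarrow> real) (N :: nat) (xi :: nat \<Rightarrow> real ^ 'm)
     (\<rho> :: ((real ^ 'm) \<times> (real ^ 'm)) measure \<Rightarrow> ((real ^ 'm) \<times> (real ^ 'm) \<Rightarrow> real) \<Rightarrow> ennreal)
     (\<epsilon> :: real).
     convex \<Xi> \<and> is_norm nrm \<and> 1 \<le> N \<and> (\<forall>i\<in>{1..N}. xi i \<in> \<Xi>) \<and>
     law_invariant_coherent_risk_measure \<rho> \<and> 0 < \<epsilon> \<and>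
     \<not> mixture_convex (feasible_set \<Xi> nrm N xi \<rho> \<epsilon>) \<and>
     (\<forall>loss \<in> borel_measurable (restrict_space borel \<Xi>).
        \<not> convex_maximization_problem (feasible_set \<Xi> nrm N xi \<rho> \<epsilon>)
             (\<lambda>P. extended_expectation P (\<lambda>(x, y). loss y)))"
proof -
  let ?F = "feasible_set (UNIV :: (real ^ 'm) set) norm 1 (\<lambda>_. 0) mean_esssup_risk 3"
  let ?d = "\<lambda>(x :: real ^ 'm, y). norm (x - y)"
  obtain e :: "real ^ 'm" where e: "norm e = 1"
    using vector_choose_size[of 1] by auto
  \<comment> \<open>The distance is constantly \<open>\<bar>t\<bar>\<close> under \<open>\<delta> t\<close> and uniform on \<open>{0, 4}\<close> under \<open>Q\<close>.\<close>
  define \<delta> where "\<delta> t = return borel (0 :: real ^ 'm, t *\<^sub>R e)" for t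
  define Q where "Q = mixture (1/2) (\<delta> 0) (\<delta> 4)"
  have d [measurable]: "?d \<in> borel_measurable borel"
    by (intro borel_measurable_continuous_onI) (auto simp: case_prod_beta intro!: continuous_intros)
  have fst: "(fst :: (real ^ 'm) \<times> (real ^ 'm) \<Rightarrow> _) \<in> borel \<rightarrow>\<^sub>M borel"
    by (intro borel_measurable_continuous_onI continuous_intros)
  have prob_\<delta>: "prob_space (\<delta> t)" for t
    by (simp add: \<delta>_def prob_space_return)
  have sets_\<delta>: "sets (\<delta> t) = sets borel" for t
    by (simp add: \<delta>_def)
  have d_\<delta>: "f \<in> borel_measurable borel \<Longrightarrow> (\<lambda>p. f p) \<in> borel_measurable (\<delta> t)"
    for f :: "_ \<Rightarrow> 'c::topological_space" and t
    by (simp add: \<delta>_def)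
  have fst_\<delta>: "fst \<in> \<delta> t \<rightarrow>\<^sub>M borel" for t
    using fst by (simp add: \<delta>_def)
  have distr_\<delta>: "distr (\<delta> t) borel fst = return borel 0" for t
    using fst by (simp add: \<delta>_def distr_return)
  have mean_\<delta>: "(\<integral>\<^sup>+p. ennreal (?d p) \<partial>\<delta> t) = ennreal \<bar>t\<bar>" for t
    unfolding \<delta>_def by (subst nn_integral_return) (simp_all add: e)
  have sup_\<delta>: "esssup (\<delta> t) (\<lambda>p. ennreal (?d p)) = ennreal \<bar>t\<bar>" for t
    unfolding \<delta>_def by (subst esssup_return) (simp_all add: e)
  have mean_Q: "(\<integral>\<^sup>+p. ennreal (?d p) \<partial>Q) = 2"
    unfolding Q_def
    by (subst nn_integral_mixture)
      (simp_all add: sets_\<delta> mean_\<delta> d_\<delta> del: ennreal_half flip: ennreal_mult ennreal_numeral)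
  have sup_Q: "esssup Q (\<lambda>p. ennreal (?d p)) = 4"
    unfolding Q_def
    by (subst esssup_mixture) (simp_all add: sets_\<delta> sup_\<delta> d_\<delta>)
  have sets_Q: "sets Q = sets borel"
    by (simp add: Q_def sets_\<delta>)
  have mem: "P \<in> ?F \<longleftrightarrow> prob_space P \<and> sets P = sets borel \<and>
      distr P borel fst = return borel 0 \<and> mean_esssup_risk P ?d \<le> 3" for P
    by (simp add: feasible_set_def empirical_distribution_const restrict_space_borel_UNIV)
  have "\<delta> 3 \<in> ?F"
    unfolding mem mean_esssup_risk_def mean_\<delta> sup_\<delta>
    by (simp add: prob_\<delta> sets_\<delta> distr_\<delta> del: ennreal_half flip: ennreal_mult ennreal_plus ennreal_numeral)
  moreover have "Q \<in> ?F"
  proof -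
    have "distr Q borel fst = return borel 0"
      unfolding Q_def
      by (subst distr_mixture) (simp_all add: sets_\<delta> fst_\<delta> distr_\<delta> mixture_same)
    moreover have "prob_space Q"
      unfolding Q_def by (intro prob_space_mixture) (simp_all add: prob_\<delta> sets_\<delta>)
    moreover have "mean_esssup_risk Q ?d \<le> 3"
      unfolding mean_esssup_risk_def mean_Q sup_Q
      by (simp del: ennreal_half flip: ennreal_mult ennreal_plus ennreal_numeral)
    ultimately show ?thesis
      unfolding mem using sets_Q by simp
  qed
  moreover have "mixture (1/2) (\<delta> 3) Q \<notin> ?F"
  proof -
    have "mean_esssup_risk (mixture (1/2) (\<delta> 3) Q) ?d = ennreal (13/4)"
      by (subst mean_esssup_risk_mixture)
        (simp_all add: sets_\<delta> sets_Q d_\<delta> mean_\<delta> sup_\<delta> mean_Q sup_Q max_def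
          del: ennreal_half ennreal_1 flip: ennreal_mult ennreal_plus ennreal_numeral ennreal_1)
    also have "\<not> ennreal (13/4) \<le> 3"
      by (simp flip: ennreal_numeral)
    finally show ?thesis
      unfolding mem by simp
  qed
  ultimately have nonconvex: "\<not> mixture_convex ?F"
    unfolding mixture_convex_def
    by (metis atLeastAtMost_iff divide_le_eq_1_pos half_gt_zero_iff less_eq_real_def one_le_numeral
        zero_less_numeral zero_less_one)
  have "is_norm (norm :: real ^ 'm \<Rightarrow> real)"
    by (simp add: is_norm_def norm_triangle_ineq)
  with nonconvex show ?thesis
    using law_invariant_coherent_mean_esssup_risk
    by (intro exI[of _ UNIV] exI[of _ norm] exI[of _ 1] exI[of _ "\<lambda>_. 0"]
        exI[of _ mean_esssup_risk] exI[of _ 3]) (simp add: convex_maximization_problem_def)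
qed

end
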